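(* Let $w_1$ be a binary word starting with $0$ and having at least $3$ runs. A circular permutation $[\tau]$ is contained in $[IG(w_1)]$ if and only if $[\tau] = [IG(w_2)]$ for some binary word $w_2 = 0^{n_1}1^{n_2}0^{n_3}\cdots 1^{n_k}0^m$ (with all $n_i \geq 1$ and $m \geq 0$) such that $1^i0^{n_1}1^{n_2}\cdots 1^{n_k}0^{m-i}$ is a subsequence of $w_1$ for some $i \in \{0,1,\dots,m\}$.
   Context: A run of a binary word is a maximal block of consecutive equal letters; subsequences need not be contiguous. For a binary word $w=w_1\cdots w_n$ starting with $0$ with at least $3$ runs, $G(w)$ is the permutation of $[n]$ with exactly one descent such that, for each $i$, $w_i=0$ iff the value $n-i+1$ appears after the descent; if $w$ starts with $0$ and has at most $2$ runs, $G(w)=12\cdots n$. $IG(w)$ denotes the inverse permutation of $G(w)$. A circular permutation $[\pi]$ is the set of all rotations of $\pi$; $[\sigma]$ contains $[\pi]$ if some rotation of $\sigma$ has a subsequence order-isomorphic to $\pi$. *)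

theory Defs
  imports Main "HOL-Library.Z2" "HOL-Library.Sublist" "HOL-Combinatorics.Multiset_Permutations"
begin

text \<open>Binary words are lists over the two-element type \<^typ>\<open>bit\<close>. A permutation of
  $[n]$ is given in one-line notation, that is, as an element of
  \<^term>\<open>permutations_of_set {1..n::nat}\<close>; list indices start at 0, so the letter $w_i$ is
  \<^term>\<open>w ! (i - 1)\<close>.\<close>

text \<open>A run is recorded by the (0-based) positions of its first and last letter.\<close>

definition runs :: "'a list \<Rightarrow> (nat \<times> nat) set" where
  "runs w = {(a, b). a \<le> b \<and> b < length w \<and> (\<forall>j\<in>{a..b}. w ! j = w ! a) \<and>
     (a = 0 \<or> w ! (a - 1) \<noteq> w ! a) \<and> (Suc b = length w \<or> w ! Suc b \<noteq> w ! b)}"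

text \<open>\<open>d\<close> is a descent if $\pi_d > \pi_{d+1}$; the entries appearing after it are those of
  \<^term>\<open>drop d \<pi>\<close>.\<close>

definition descents :: "nat list \<Rightarrow> nat set" where
  "descents \<pi> = {d. 1 \<le> d \<and> d < length \<pi> \<and> \<pi> ! (d - 1) > \<pi> ! d}"

text \<open>Only used for words that are empty or start with 0. In the first case below the permutation
  exists and is unique for such words.\<close>

definition G :: "bit list \<Rightarrow> nat list" where
  "G w = (let n = length w in
     if card (runs w) \<ge> 3 then
       (THE \<pi>. \<pi> \<in> permutations_of_set {1..n} \<and>
          (\<exists>d. descents \<pi> = {d} \<and>
             (\<forall>i\<in>{1..n}. w ! (i - 1) = 0 \<longleftrightarrow> n - i + 1 \<in> set (drop d \<pi>))))
     else [1..<Suc n])"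

definition inverse_perm :: "nat list \<Rightarrow> nat list" where
  "inverse_perm \<pi> = map (\<lambda>v. THE p. p \<in> {1..length \<pi>} \<and> \<pi> ! (p - 1) = v) [1..<Suc (length \<pi>)]"

definition IG :: "bit list \<Rightarrow> nat list" where
  "IG w = inverse_perm (G w)"

definition circ :: "'a list \<Rightarrow> 'a list set" where
  "circ \<pi> = {rotate k \<pi> | k. True}"

definition order_isomorphic :: "nat list \<Rightarrow> nat list \<Rightarrow> bool" where
  "order_isomorphic xs ys \<longleftrightarrow> length xs = length ys \<and>
     (\<forall>i<length xs. \<forall>j<length xs. xs ! i < xs ! j \<longleftrightarrow> ys ! i < ys ! j)"

text \<open>\<open>circ_contains \<sigma> \<pi>\<close>: the circular permutation $[\sigma]$ contains $[\pi]$.\<close>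

definition circ_contains :: "nat list \<Rightarrow> nat list \<Rightarrow> bool" where
  "circ_contains \<sigma> \<pi> \<longleftrightarrow> (\<exists>\<rho>\<in>circ \<sigma>. \<exists>s. subseq s \<rho> \<and> order_isomorphic s \<pi>)"

text \<open>For \<open>ns\<close> = $[n_1, \ldots, n_k]$ this is $0^{n_1} 1^{n_2} 0^{n_3} 1^{n_4} \cdots$
  ($k$ blocks).\<close>

definition alt_word :: "nat list \<Rightarrow> bit list" where
  "alt_word ns = concat (map (\<lambda>j. replicate (ns ! j) (if even j then 0 else 1)) [0..<length ns])"

end

theory Submission imports Defs begin

text \<open>Call \<open>\<pi>\<close> coherent with a binary word \<open>u\<close> of the same length if the entries at the 1s of \<open>u\<close>
  are increasing, those at the 0s are increasing, and the former lie below the latter. Then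
  \<open>IG w\<close> is the only permutation of $[n]$ coherent with the reverse of \<open>w\<close>. Coherence passes to
  subsequences, so the patterns in \<open>IG w\<close> are exactly the permutations coherent with reversed
  subwords of \<open>w\<close>. Moving a final block of \<open>\<pi>\<close> at letters $1^i$ to the front and relabelling it
  $0^i$ preserves coherence, so cyclically the subword $1^i A 0^j$ yields the same permutation as
  $A 0^{i+j}$; and every binary word has the form $1^i A 0^j$ with \<open>A\<close> empty or starting
  with 0 and ending with 1.\<close>

section \<open>Sequences coherent with a binary word\<close>

definition pair_ok :: "bit \<times> nat \<Rightarrow> bit \<times> nat \<Rightarrow> bool" where
  "pair_ok p q \<longleftrightarrow> (if fst p = 0 \<and> fst q = 1 then snd q < snd p else snd p < snd q)"

text \<open>That \<open>sorted_wrt\<close> compares all pairs and not only neighbours matters, since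
  \<open>pair_ok\<close> is not transitive: the values 3, 1, 2 at the letters 0, 1, 0 satisfy it
  between neighbours, yet the entries at the 0s decrease.\<close>

definition coherent :: "bit list \<Rightarrow> nat list \<Rightarrow> bool" where
  "coherent u \<pi> \<longleftrightarrow> length u = length \<pi> \<and> sorted_wrt pair_ok (zip u \<pi>)"

lemma coherent_nth:
  "coherent u \<pi> \<longleftrightarrow> length u = length \<pi> \<and>
     (\<forall>i j. i < j \<longrightarrow> j < length \<pi> \<longrightarrow>
       (if u ! i = 0 \<and> u ! j = 1 then \<pi> ! j < \<pi> ! i else \<pi> ! i < \<pi> ! j))"
  unfolding coherent_def sorted_wrt_iff_nth_less pair_ok_def by auto

text \<open>The right-hand side involves only \<open>u\<close> and the two indices, so the word
  alone fixes the order type of \<open>\<pi>\<close>.\<close>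

lemma coherent_less_iff:
  assumes "coherent u \<pi>" "i < length \<pi>" "j < length \<pi>"
  shows "\<pi> ! i < \<pi> ! j \<longleftrightarrow> (if u ! i = u ! j then i < j else u ! i = 1)"
proof -
  have *: "if u ! a = 0 \<and> u ! b = 1 then \<pi> ! b < \<pi> ! a else \<pi> ! a < \<pi> ! b"
    if "a < b" "b < length \<pi>" for a b
    using assms(1) that unfolding coherent_nth by blast
  consider "i < j" | "i = j" | "j < i" by linarith
  then show ?thesis
  proof cases
    case 1
    then show ?thesis using *[of i j] assms(3)
      by (cases "u ! i"; cases "u ! j"; simp)
  next
    case 3
    then show ?thesis using *[of j i] assms(2)
      by (cases "u ! i"; cases "u ! j"; simp)
  qed simp
qed

lemma coherent_order_isomorphic:
  assumes "coherent u s" "coherent u t"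
  shows "order_isomorphic s t"
  using assms coherent_less_iff[OF assms(1)] coherent_less_iff[OF assms(2)]
  unfolding order_isomorphic_def coherent_def by auto

lemma order_isomorphic_coherent:
  assumes "order_isomorphic s t" "coherent u s"
  shows "coherent u t"
  using assms unfolding order_isomorphic_def coherent_nth
  by (metis order.strict_trans)

lemma sorted_wrt_nths: "sorted_wrt R xs \<Longrightarrow> sorted_wrt R (nths xs N)"
  by (induction xs arbitrary: N) (auto simp: nths_Cons dest: in_set_nthsD)

lemma coherent_nths:
  assumes "coherent u \<pi>"
  shows "coherent (nths u N) (nths \<pi> N)"
proof -
  have len: "length u = length \<pi>" using assms by (simp add: coherent_def)
  \<comment> \<open>Since \<open>nths\<close> commutes with \<open>map\<close>, choosing positions
    in the zipped list chooses the same positions in both components.\<close>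
  let ?zs = "nths (zip u \<pi>) N"
  have "map fst ?zs = nths u N" "map snd ?zs = nths \<pi> N"
    unfolding nths_map[symmetric] using len by simp_all
  then have "nths u N = map fst ?zs" "nths \<pi> N = map snd ?zs" by simp_all
  then show ?thesis using assms unfolding coherent_def
    by (simp add: zip_map_fst_snd sorted_wrt_nths)
qed

text \<open>An entry at a final 1 must exceed the entries at earlier 1s and lie below those at
  earlier 0s. At the front with letter 0 it must satisfy exactly the same inequalities (fact
  \<open>X1\<close>). Among themselves the moved entries must increase under either letter (fact
  \<open>R\<close>).\<close>

lemma coherent_rotate:
  assumes "length Y = i"
  shows "coherent (u @ replicate i 1) (X @ Y) \<longleftrightarrow> coherent (replicate i 0 @ u) (Y @ X)"
proof (cases "length u = length X")
  case True
  have R: "sorted_wrt pair_ok (zip (replicate i c) Y) \<longleftrightarrow> sorted_wrt (<) Y" for c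
    using assms unfolding sorted_wrt_iff_nth_less pair_ok_def by (cases c) auto
  have X1: "pair_ok x (1, y) \<longleftrightarrow> pair_ok (0, y) x" for x y
    by (cases "fst x"; simp add: pair_ok_def)
  have S: "set (zip (replicate i c) Y) = (\<lambda>y. (c, y)) ` set Y" for c
    using assms by (auto simp: zip_replicate1)
  show ?thesis
    using True assms R X1 by (auto simp: coherent_def sorted_wrt_append S)
next
  \<comment> \<open>Here word and sequence differ in length on either side, so both sides are
    false.\<close>
  case False
  then show ?thesis using assms by (auto simp: coherent_def)
qed

text \<open>In a permutation of [n] an entry is one more than the number of smaller entries, and
  that number depends on the order type only.\<close>

lemma order_isomorphic_perm_eq:
  assumes "xs \<in> permutations_of_set {1..n}" "ys \<in> permutations_of_set {1..n}"
    "order_isomorphic xs ys"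
  shows "xs = ys"
proof -
  have rank: "card {j. j < n \<and> zs ! j < zs ! i} = zs ! i - 1" "1 \<le> zs ! i" "length zs = n"
    if "zs \<in> permutations_of_set {1..n}" "i < n" for zs :: "nat list" and i
  proof -
    have d: "distinct zs" and s: "set zs = {1..n}" using that by (auto simp: permutations_of_set_def)
    show len: "length zs = n" using distinct_card[OF d] s by simp
    show "1 \<le> zs ! i" using s that len nth_mem by fastforce
    have "zs ! i \<le> n" using s that len nth_mem by fastforce
    \<comment> \<open>Distinctness gives injectivity; surjectivity holds because every value below
      \<open>zs ! i \<le> n\<close> occurs in \<open>zs\<close>.\<close>
    have "bij_betw ((!) zs) {j. j < n \<and> zs ! j < zs ! i} {1..<zs ! i}"
      unfolding bij_betw_def
    proof
      show "inj_on ((!) zs) {j. j < n \<and> zs ! j < zs ! i}"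
        using d len by (auto simp: inj_on_def nth_eq_iff_index_eq)
      show "(!) zs ` {j. j < n \<and> zs ! j < zs ! i} = {1..<zs ! i}"
      proof (intro equalityI subsetI)
        fix x assume "x \<in> (!) zs ` {j. j < n \<and> zs ! j < zs ! i}"
        then show "x \<in> {1..<zs ! i}" using s len nth_mem by fastforce
      next
        fix x assume x: "x \<in> {1..<zs ! i}"
        then have "x \<in> set zs" using s \<open>zs ! i \<le> n\<close> by auto
        then obtain j where "j < n" "zs ! j = x" using len by (auto simp: in_set_conv_nth)
        then show "x \<in> (!) zs ` {j. j < n \<and> zs ! j < zs ! i}" using x by auto
      qed
    qed
    then show "card {j. j < n \<and> zs ! j < zs ! i} = zs ! i - 1"
      by (simp add: bij_betw_same_card)
  qed
  have len: "length xs = n" "length ys = n"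
    using assms(1,2) by (simp_all add: length_finite_permutations_of_set)
  show ?thesis
  proof (rule nth_equalityI)
    fix i assume "i < length xs"
    then have i: "i < n" using len by simp
    have "{j. j < n \<and> xs ! j < xs ! i} = {j. j < n \<and> ys ! j < ys ! i}"
      using assms(3) i len unfolding order_isomorphic_def by auto
    then show "xs ! i = ys ! i" using rank[OF assms(1) i] rank[OF assms(2) i] by simp
  qed (use len in simp)
qed

section \<open>Runs of a binary word\<close>

lemma in_runs_iff:
  "(a, b) \<in> runs w \<longleftrightarrow> a \<le> b \<and> b < length w \<and> (\<forall>j. a \<le> j \<longrightarrow> j \<le> b \<longrightarrow> w ! j = w ! a) \<and>
     (a = 0 \<or> w ! (a - 1) \<noteq> w ! a) \<and> (Suc b = length w \<or> w ! Suc b \<noteq> w ! b)"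
  unfolding runs_def mem_Collect_eq case_prod_conv Ball_def atLeastAtMost_iff by blast

lemma runsD:
  assumes "(a, b) \<in> runs w"
  shows "a \<le> b" "b < length w" "\<And>j. a \<le> j \<Longrightarrow> j \<le> b \<Longrightarrow> w ! j = w ! a"
    "a \<noteq> 0 \<Longrightarrow> w ! (a - 1) \<noteq> w ! a" "Suc b \<noteq> length w \<Longrightarrow> w ! Suc b \<noteq> w ! b"
  using assms unfolding in_runs_iff by blast+

lemma finite_runs: "finite (runs w)"
proof (rule finite_subset)
  show "runs w \<subseteq> {..<length w} \<times> {..<length w}"
  proof clarify
    fix a b assume "(a, b) \<in> runs w"
    then show "a \<in> {..<length w} \<and> b \<in> {..<length w}" using runsD(1,2)[of a b w] by simp
  qed
qed simp

text \<open>The run is found by extending the position \<open>p\<close> to the least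
  \<open>a\<close> and the greatest \<open>b\<close> between which the letter stays constant. An
  equal letter just outside would contradict the extremal choice.\<close>

lemma run_containing:
  assumes "p < length w"
  shows "\<exists>a b. (a, b) \<in> runs w \<and> a \<le> p \<and> p \<le> b"
proof -
  define L where "L a \<longleftrightarrow> a \<le> p \<and> (\<forall>j. a \<le> j \<longrightarrow> j \<le> p \<longrightarrow> w ! j = w ! p)" for a
  define B where "B = {b. p \<le> b \<and> b < length w \<and> (\<forall>j. p \<le> j \<longrightarrow> j \<le> b \<longrightarrow> w ! j = w ! p)}"
  define a where "a = (LEAST a. L a)"
  define b where "b = Max B"
  have "L a" unfolding a_def by (rule LeastI[of L p]) (simp add: L_def)
  then have a: "a \<le> p" "\<And>j. a \<le> j \<Longrightarrow> j \<le> p \<Longrightarrow> w ! j = w ! p"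
    unfolding L_def by blast+
  have fin: "finite B" unfolding B_def by simp
  moreover have "p \<in> B" using assms by (simp add: B_def)
  ultimately have "b \<in> B" unfolding b_def by (intro Max_in) auto
  then have b: "p \<le> b" "b < length w" "\<And>j. p \<le> j \<Longrightarrow> j \<le> b \<Longrightarrow> w ! j = w ! p"
    unfolding B_def mem_Collect_eq by blast+
  have ab: "w ! j = w ! p" if "a \<le> j" "j \<le> b" for j
    using a(2)[OF that(1)] b(3)[OF _ that(2)] linear[of j p] by metis
  have "a = 0 \<or> w ! (a - 1) \<noteq> w ! a"
  proof (rule ccontr)
    assume *: "\<not> ?thesis"
    have "w ! j = w ! p" if "a - 1 \<le> j" "j \<le> p" for j
    proof (cases "j = a - 1")
      case True
      then show ?thesis using * a(2)[of a] a(1) by simp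
    next
      case False
      then show ?thesis using a(2)[of j] that by simp
    qed
    moreover have "a - 1 \<le> p" using a(1) by simp
    ultimately have "L (a - 1)" unfolding L_def by blast
    then have "\<not> a - 1 < a" using not_less_Least[of "a - 1" L] unfolding a_def[symmetric] by blast
    \<comment> \<open>The negated disjunction \<open>*\<close> contains \<open>a \<noteq> 0\<close>,
      so the truncated subtraction really decreases \<open>a\<close>.\<close>
    moreover have "a - 1 < a" using * by (simp only: de_Morgan_disj) simp
    ultimately show False by blast
  qed
  moreover have "Suc b = length w \<or> w ! Suc b \<noteq> w ! b"
  proof (rule ccontr)
    assume *: "\<not> ?thesis"
    have "w ! j = w ! p" if "p \<le> j" "j \<le> Suc b" for j
    proof (cases "j = Suc b")
      case True
      then show ?thesis using * b(3)[of b] b(1) by simp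
    next
      case False
      then show ?thesis using b(3)[of j] that by simp
    qed
    moreover have "p \<le> Suc b" "Suc b < length w" using * b(1,2) by simp_all
    ultimately have "Suc b \<in> B" unfolding B_def by blast
    then have "Suc b \<le> b" unfolding b_def using fin by (intro Max_ge)
    then show False by simp
  qed
  moreover have "\<forall>j. a \<le> j \<longrightarrow> j \<le> b \<longrightarrow> w ! j = w ! a" using ab a(2)[OF order_refl a(1)] by metis
  moreover have "a \<le> b" using a(1) b(1) by simp
  ultimately have "(a, b) \<in> runs w" using b(2) unfolding in_runs_iff by blast
  then show ?thesis using a(1) b(1) by blast
qed

text \<open>If a 1 precedes a 0, then the runs at the initial 0, at this 1 and at this 0 are
  different. Otherwise the word consists of 0s followed by 1s, and each letter has at most one run.
  This is the only information on runs needed for \<open>G\<close>.\<close>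

lemma three_runs_iff:
  fixes w :: "bit list"
  assumes "w \<noteq> []" "hd w = 0"
  shows "card (runs w) \<ge> 3 \<longleftrightarrow> (\<exists>i j. i < j \<and> j < length w \<and> w ! i = 1 \<and> w ! j = 0)"
proof
  assume "\<exists>i j. i < j \<and> j < length w \<and> w ! i = 1 \<and> w ! j = 0"
  then obtain i j where ij: "i < j" "j < length w" "w ! i = 1" "w ! j = 0" by blast
  have w0: "w ! 0 = 0" using assms by (simp add: hd_conv_nth)
  obtain a b where r0: "(a, b) \<in> runs w" "a \<le> 0" "0 \<le> b" using run_containing[of 0 w] assms by auto
  obtain c d where r1: "(c, d) \<in> runs w" "c \<le> i" "i \<le> d" using run_containing[of i w] ij by auto
  obtain e f where r2: "(e, f) \<in> runs w" "e \<le> j" "j \<le> f" using run_containing[of j w] ij by auto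
  have "w ! a = 0" "w ! c = 1" "w ! e = 0"
    using runsD(3)[OF r0(1), of 0] runsD(3)[OF r1(1,2)] runsD(3)[OF r2(1,2)] r0 r1 r2 ij w0 by simp_all
  \<comment> \<open>A run containing both positions 0 and \<open>j\<close> would also contain
    \<open>i\<close>, where the letter is 1.\<close>
  moreover have "(a, b) \<noteq> (e, f)"
  proof
    assume "(a, b) = (e, f)"
    then have "w ! i = w ! a" using runsD(3)[OF r0(1), of i] r0 r2 ij by simp
    then show False using ij \<open>w ! a = 0\<close> by simp
  qed
  moreover from calculation have "(a, b) \<noteq> (c, d)" "(c, d) \<noteq> (e, f)" by auto
  ultimately have "card {(a, b), (c, d), (e, f)} = 3" by (simp add: card_insert_if del: prod.inject)
  then show "card (runs w) \<ge> 3"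
    using card_mono[OF finite_runs, of "{(a, b), (c, d), (e, f)}" w] r0 r1 r2 by auto
next
  assume three: "card (runs w) \<ge> 3"
  show "\<exists>i j. i < j \<and> j < length w \<and> w ! i = 1 \<and> w ! j = 0"
  proof (rule ccontr)
    assume "\<not> ?thesis"
    then have no: "\<And>i j. i < j \<Longrightarrow> j < length w \<Longrightarrow> w ! i = 1 \<Longrightarrow> w ! j = 0 \<Longrightarrow> False" by blast
    \<comment> \<open>A run of 0s starting later would be preceded by a 1, which \<open>no\<close>
      forbids; likewise for a run of 1s ending early in \<open>stop\<close>.\<close>
    have start: "a = 0" if "(a, b) \<in> runs w" "w ! a = 0" for a b
    proof (rule ccontr)
      assume "a \<noteq> 0"
      then have "w ! (a - 1) = 1" using runsD(4)[OF that(1)] that(2) by (cases "w ! (a - 1)") simp_all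
      then show False using no[of "a - 1" a] runsD(1,2)[OF that(1)] that(2) \<open>a \<noteq> 0\<close> by simp
    qed
    have stop: "Suc b = length w" if "(a, b) \<in> runs w" "w ! a = 1" for a b
    proof (rule ccontr)
      assume *: "Suc b \<noteq> length w"
      have "w ! b = 1" using runsD(3)[OF that(1), of b] runsD(1)[OF that(1)] that(2) by simp
      moreover from this have "w ! Suc b = 0"
        using runsD(5)[OF that(1) *] by (cases "w ! Suc b") simp_all
      ultimately show False using no[of b "Suc b"] runsD(2)[OF that(1)] * by simp
    qed
    \<comment> \<open>The letter fixes one end of the run by \<open>start\<close> or
      \<open>stop\<close>, and maximality then fixes the other end. Two letters thus allow at most
      two runs.\<close>
    have inj: "inj_on (\<lambda>r. w ! fst r) (runs w)"
    proof (rule inj_onI, clarify)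
      fix a b a' b'
      assume r: "(a, b) \<in> runs w" "(a', b') \<in> runs w" and "w ! fst (a, b) = w ! fst (a', b')"
      then have eq: "w ! a = w ! a'" by simp
      show "a = a' \<and> b = b'"
      proof (cases "w ! a")
        case zero
        then have a: "a = 0" "a' = 0" using start[OF r(1)] start[OF r(2)] eq by simp_all
        have "\<not> y < z" if y: "(0, y) \<in> runs w" and z: "(0, z) \<in> runs w" for y z
        proof
          assume "y < z"
          then show False
            using runsD(3)[OF y, of y] runsD(3)[OF z, of "Suc y"] runsD(5)[OF y] runsD(2)[OF z] by simp
        qed
        then show ?thesis using r a by (meson linorder_neqE_nat)
      next
        case one
        then have b: "b' = b" using stop[OF r(1)] stop[OF r(2)] eq by simp
        have "\<not> y < z" if y: "(y, b) \<in> runs w" and z: "(z, b) \<in> runs w" for y z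
        proof
          assume "y < z"
          then show False
            using runsD(3)[OF y, of "z - 1"] runsD(3)[OF y, of z] runsD(4)[OF z] runsD(1)[OF z] by simp
        qed
        then show ?thesis using r b by (meson linorder_neqE_nat)
      qed
    qed
    have "x \<in> {0, 1}" for x :: bit by (cases x) simp_all
    then have "(\<lambda>r. w ! fst r) ` runs w \<subseteq> {0, 1}" by blast
    then have "card ((\<lambda>r. w ! fst r) ` runs w) \<le> card {0, 1 :: bit}"
      by (intro card_mono) simp_all
    then show False using card_image[OF inj] three by simp
  qed
qed

section \<open>Inverse permutations and permutations with one descent\<close>

text \<open>Indexing by the position \<open>p\<close> instead of the value avoids the description
  operator later on. The shifts by one arise because values and positions count from 1 and list
  indices from 0.\<close>

lemma inverse_perm_nth:
  assumes "\<pi> \<in> permutations_of_set {1..n}" "p < n"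
  shows "inverse_perm \<pi> ! (\<pi> ! p - 1) = Suc p"
proof -
  have d: "distinct \<pi>" and s: "set \<pi> = {1..n}" using assms by (auto simp: permutations_of_set_def)
  have len: "length \<pi> = n" using distinct_card[OF d] s by simp
  have v: "1 \<le> \<pi> ! p" "\<pi> ! p \<le> n" using s assms(2) len nth_mem by fastforce+
  have "(THE q. q \<in> {1..length \<pi>} \<and> \<pi> ! (q - 1) = \<pi> ! p) = Suc p"
  proof (rule the_equality)
    fix q assume "q \<in> {1..length \<pi>} \<and> \<pi> ! (q - 1) = \<pi> ! p"
    then have "q - 1 = p" "1 \<le> q" using d assms(2) len by (auto simp: nth_eq_iff_index_eq)
    then show "q = Suc p" by simp
  qed (use assms len in auto)
  then show ?thesis using v len unfolding inverse_perm_def by (simp del: upt_Suc)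
qed

text \<open>Each \<open>x\<close> in [n] is the position of some value, so the inverse covers [n]; a
  list of length \<open>n\<close> with \<open>n\<close> different members is distinct.\<close>

lemma inverse_perm_perm:
  assumes "\<pi> \<in> permutations_of_set {1..n}"
  shows "inverse_perm \<pi> \<in> permutations_of_set {1..n}"
proof -
  have d: "distinct \<pi>" and s: "set \<pi> = {1..n}" using assms by (auto simp: permutations_of_set_def)
  have len: "length \<pi> = n" using distinct_card[OF d] s by simp
  have len': "length (inverse_perm \<pi>) = n" using len by (simp add: inverse_perm_def)
  have sub: "{1..n} \<subseteq> set (inverse_perm \<pi>)"
  proof
    fix x assume x: "x \<in> {1..n}"
    then have "\<pi> ! (x - 1) \<in> {1..n}" using s len nth_mem[of "x - 1" \<pi>] by auto
    then have "\<pi> ! (x - 1) - 1 < length (inverse_perm \<pi>)" using len' by auto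
    moreover have "inverse_perm \<pi> ! (\<pi> ! (x - 1) - 1) = x"
      using inverse_perm_nth[OF assms, of "x - 1"] x by auto
    ultimately show "x \<in> set (inverse_perm \<pi>)" by (metis nth_mem)
  qed
  have "card (set (inverse_perm \<pi>)) \<le> card {1..n}" using card_length[of "inverse_perm \<pi>"] len' by simp
  then have eq: "{1..n} = set (inverse_perm \<pi>)" using sub by (intro card_seteq) auto
  then have "distinct (inverse_perm \<pi>)" using len' by (intro card_distinct) (metis card_atLeastAtMost diff_Suc_1)
  then show ?thesis using eq by (auto simp: permutations_of_set_def)
qed

text \<open>The inverse lists the positions of the values 1, 2, and so on. Values behind the cut
  \<open>d\<close>, marked 0, have larger positions than those before it, marked 1. On either side
  of the cut \<open>\<pi>\<close> increases, so there larger values have larger positions.\<close>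

lemma coherent_inverse_perm:
  assumes perm: "\<pi> \<in> permutations_of_set {1..n}" and len: "length u = n"
    and sorted: "sorted_wrt (<) (take d \<pi>)" "sorted_wrt (<) (drop d \<pi>)"
    and zeros: "\<And>i. i < n \<Longrightarrow> u ! i = 0 \<longleftrightarrow> Suc i \<in> set (drop d \<pi>)"
  shows "coherent u (inverse_perm \<pi>)"
proof -
  have D: "distinct \<pi>" and s: "set \<pi> = {1..n}" using perm by (auto simp: permutations_of_set_def)
  have lenp: "length \<pi> = n" using distinct_card[OF D] s by simp
  have len': "length (inverse_perm \<pi>) = n" using lenp by (simp add: inverse_perm_def)
  have pos: "\<exists>p<n. \<pi> ! p = Suc i \<and> inverse_perm \<pi> ! i = Suc p \<and> (u ! i = 0 \<longleftrightarrow> d \<le> p)"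
    if "i < n" for i
  proof -
    have "Suc i \<in> set \<pi>" using s that by auto
    then obtain p where p: "p < n" "\<pi> ! p = Suc i" using lenp by (auto simp: in_set_conv_nth)
    have "Suc i \<in> set (drop d \<pi>) \<longleftrightarrow> d \<le> p"
    proof
      assume "Suc i \<in> set (drop d \<pi>)"
      then obtain k where "k < n - d" "\<pi> ! (d + k) = Suc i" using lenp
        by (auto simp: in_set_conv_nth)
      then have "p = d + k" using D p lenp nth_eq_iff_index_eq[of \<pi> p "d + k"] by auto
      then show "d \<le> p" by simp
    next
      assume "d \<le> p"
      then have "drop d \<pi> ! (p - d) = Suc i" "p - d < length (drop d \<pi>)" using p lenp by auto
      then show "Suc i \<in> set (drop d \<pi>)" by (metis nth_mem)
    qed
    then show ?thesis using p inverse_perm_nth[OF perm p(1)] zeros[OF that] by auto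
  qed
  have inc: "\<pi> ! p < \<pi> ! q" if "p < q" "q < n" "q < d \<or> d \<le> p" for p q
  proof (cases "q < d")
    case True
    then have "take d \<pi> ! p < take d \<pi> ! q"
      using sorted(1) that lenp by (simp add: sorted_wrt_iff_nth_less)
    then show ?thesis using True that by simp
  next
    case False
    then have "drop d \<pi> ! (p - d) < drop d \<pi> ! (q - d)"
      using that lenp by (intro sorted_wrt_nth_less[OF sorted(2)]) auto
    then show ?thesis using False that lenp by simp
  qed
  show ?thesis unfolding coherent_nth
  proof (intro conjI allI impI)
    show "length u = length (inverse_perm \<pi>)" using len len' by simp
  next
    fix i j assume ij: "i < j" "j < length (inverse_perm \<pi>)"
    then obtain p where p: "p < n" "\<pi> ! p = Suc i" "inverse_perm \<pi> ! i = Suc p" "u ! i = 0 \<longleftrightarrow> d \<le> p"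
      using pos[of i] len' by auto
    obtain q where q: "q < n" "\<pi> ! q = Suc j" "inverse_perm \<pi> ! j = Suc q" "u ! j = 0 \<longleftrightarrow> d \<le> q"
      using pos[of j] len' ij by auto
    have "p \<noteq> q" using p q ij by auto
    \<comment> \<open>The larger value can stand earlier only if \<open>q < d \<le> p\<close>, that
      is, if the letters at \<open>i\<close> and \<open>j\<close> are 0 and 1; in that case
      \<open>q < p\<close> is immediate.\<close>
    moreover have "\<not> q < p" if "p < d \<or> d \<le> q"
      using inc[of q p] p q ij that by auto
    ultimately show "if u ! i = 0 \<and> u ! j = 1 then inverse_perm \<pi> ! j < inverse_perm \<pi> ! i
        else inverse_perm \<pi> ! i < inverse_perm \<pi> ! j"
      using p q by (cases "u ! i"; cases "u ! j") auto
  qed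
qed

text \<open>Adjacent steps other than the one from index \<open>d - 1\<close> to \<open>d\<close> do
  not descend, and distinctness makes them strict. By transitivity this sorts each part.\<close>

lemma sorted_between_descents:
  assumes "distinct \<pi>" "descents \<pi> = {d}"
  shows "sorted_wrt (<) (take d \<pi>)" "sorted_wrt (<) (drop d \<pi>)" "d < length \<pi>"
proof -
  have step: "\<pi> ! i < \<pi> ! Suc i" if "Suc i < length \<pi>" "Suc i \<noteq> d" for i
  proof -
    have "Suc i \<notin> descents \<pi>" using assms(2) that by simp
    then have "\<pi> ! i \<le> \<pi> ! Suc i" using that unfolding descents_def by auto
    moreover have "\<pi> ! i \<noteq> \<pi> ! Suc i" using assms(1) that by (simp add: nth_eq_iff_index_eq)
    ultimately show ?thesis by simp
  qed
  show "d < length \<pi>" using assms(2) unfolding descents_def by auto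
  then show "sorted_wrt (<) (take d \<pi>)" "sorted_wrt (<) (drop d \<pi>)"
    using step by (auto simp: sorted_wrt_iff_nth_Suc_transp)
qed

section \<open>The permutations \<open>G w\<close> and \<open>IG w\<close>\<close>

text \<open>Justifies the description operator in \<open>G\<close>: the entries behind the descent
  are prescribed as a set, and having a single descent forces both parts to be increasing. Hence the
  only candidate is \<open>\<pi>0\<close>.\<close>

lemma G_three_runs:
  assumes "w \<noteq> []" "hd w = 0" "card (runs w) \<ge> 3" "n = length w"
  shows "\<exists>d. G w \<in> permutations_of_set {1..n} \<and> descents (G w) = {d} \<and>
    (\<forall>i\<in>{1..n}. w ! (i - 1) = 0 \<longleftrightarrow> n - i + 1 \<in> set (drop d (G w)))"
proof -
  let ?P = "\<lambda>\<pi>. \<pi> \<in> permutations_of_set {1..n} \<and> (\<exists>d. descents \<pi> = {d} \<and>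
     (\<forall>i\<in>{1..n}. w ! (i - 1) = 0 \<longleftrightarrow> n - i + 1 \<in> set (drop d \<pi>)))"
  \<comment> \<open>Value \<open>v\<close> belongs to the letter with 1-based index
    \<open>n - v + 1\<close>, that is, to list index \<open>n - v\<close>.\<close>
  define Z where "Z = {v \<in> {1..n}. w ! (n - v) = 0}"
  define W where "W = {1..n} - Z"
  define \<pi>0 where "\<pi>0 = sorted_list_of_set W @ sorted_list_of_set Z"
  have fin: "finite Z" "finite W" unfolding Z_def W_def by auto
  \<comment> \<open>The map from \<open>i\<close> to \<open>n - i + 1\<close> is an involution of
    [n], so the condition on all letters determines the set \<open>A\<close>.\<close>
  have cond: "(\<forall>i\<in>{1..n}. w ! (i - 1) = 0 \<longleftrightarrow> n - i + 1 \<in> A) \<longleftrightarrow> A = Z"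
    if "A \<subseteq> {1..n}" for A
  proof
    assume *: "\<forall>i\<in>{1..n}. w ! (i - 1) = 0 \<longleftrightarrow> n - i + 1 \<in> A"
    have "v \<in> A \<longleftrightarrow> v \<in> Z" if "v \<in> {1..n}" for v
      using *[rule_format, of "n - v + 1"] that unfolding Z_def by auto
    then show "A = Z" using that unfolding Z_def by blast
  next
    assume "A = Z"
    then show "\<forall>i\<in>{1..n}. w ! (i - 1) = 0 \<longleftrightarrow> n - i + 1 \<in> A"
      unfolding Z_def by auto
  qed
  \<comment> \<open>A 1 before a 0 yields a value \<open>n - i\<close> in \<open>W\<close> above a
    value \<open>n - j\<close> in \<open>Z\<close>. So the last entry of the first list exceeds the
    first entry of the second, and the junction is a descent.\<close>
  obtain i j where ij: "i < j" "j < n" "w ! i = 1" "w ! j = 0"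
    using three_runs_iff assms by blast
  have W_nth: "n - i \<in> W" and Z_nth: "n - j \<in> Z" using ij unfolding W_def Z_def by auto
  have lenW: "length (sorted_list_of_set W) = card W" by simp
  have perm0: "\<pi>0 \<in> permutations_of_set {1..n}"
    using fin unfolding \<pi>0_def permutations_of_set_def by (auto simp: W_def Z_def)
  have cW: "card W > 0" and cZ: "card Z > 0" using W_nth Z_nth fin by (auto simp: card_gt_0_iff)
  have desc0: "descents \<pi>0 = {card W}"
  proof -
    have up: "sorted_list_of_set A ! k < sorted_list_of_set A ! l"
      if "k < l" "l < card A" for A :: "nat set" and k l
      using sorted_wrt_nth_less[OF strict_sorted_list_of_set, of k l A] that by simp
    have hiW: "n - i \<le> sorted_list_of_set W ! (card W - 1)"
    proof -
      obtain k where "k < card W" "sorted_list_of_set W ! k = n - i"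
        using W_nth fin by (metis in_set_conv_nth lenW set_sorted_list_of_set)
      then show ?thesis using up[of k "card W - 1" W] by (cases "k = card W - 1") (simp_all add: less_imp_le)
    qed
    have loZ: "sorted_list_of_set Z ! 0 \<le> n - j"
    proof -
      obtain k where "k < card Z" "sorted_list_of_set Z ! k = n - j"
        using Z_nth fin by (metis in_set_conv_nth length_sorted_list_of_set set_sorted_list_of_set)
      then show ?thesis using up[of 0 k Z] by (cases "k = 0") (simp_all add: less_imp_le)
    qed
    have "n - j < n - i" using ij by simp
    then have "card W \<in> descents \<pi>0" using hiW loZ cW cZ
      unfolding descents_def \<pi>0_def by (auto simp: nth_append)
    moreover have "e = card W" if "e \<in> descents \<pi>0" for e
    proof (rule ccontr)
      assume ne: "e \<noteq> card W"
      have e: "1 \<le> e" "e < card W + card Z" "\<pi>0 ! e < \<pi>0 ! (e - 1)"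
        using that unfolding descents_def \<pi>0_def by auto
      show False
      proof (cases "e < card W")
        case True
        then have "e - 1 < card W" by simp
        then show False using True e up[of "e - 1" e W] unfolding \<pi>0_def by (simp add: nth_append)
      next
        case False
        then have "sorted_list_of_set Z ! (e - 1 - card W) < sorted_list_of_set Z ! (e - card W)"
          using e ne by (intro up) auto
        moreover have "\<not> e - 1 < card W" using ne False by simp
        ultimately show False using e ne False unfolding \<pi>0_def by (simp add: nth_append)
      qed
    qed
    ultimately show ?thesis by blast
  qed
  have dropZ: "set (drop (card W) \<pi>0) = Z" unfolding \<pi>0_def using fin by simp
  have "Z \<subseteq> {1..n}" unfolding Z_def by blast
  then have tail0: "\<forall>i\<in>{1..n}. w ! (i - 1) = 0 \<longleftrightarrow> n - i + 1 \<in> set (drop (card W) \<pi>0)"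
    unfolding dropZ by (intro iffD2[OF cond refl])
  then have ex: "?P \<pi>0" by (intro conjI exI[of _ "card W"] perm0 desc0 tail0)
  \<comment> \<open>The condition recovers \<open>Z\<close> as the set behind the descent and
    \<open>W\<close> as its complement; both parts are sorted, hence equal to the sorted lists of
    these sets.\<close>
  have uniq: "\<pi> = \<pi>0" if P: "?P \<pi>" for \<pi>
  proof -
    obtain d where d: "descents \<pi> = {d}"
      "\<forall>i\<in>{1..n}. w ! (i - 1) = 0 \<longleftrightarrow> n - i + 1 \<in> set (drop d \<pi>)" using P by blast
    have dist: "distinct \<pi>" and s: "set \<pi> = {1..n}"
      using conjunct1[OF P] by (auto simp: permutations_of_set_def)
    have Zd: "set (drop d \<pi>) = Z"
      using s set_drop_subset[of d \<pi>] by (intro iffD1[OF cond d(2)]) simp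
    have "set (take d \<pi>) \<union> Z = {1..n}"
      unfolding Zd[symmetric] s[symmetric] set_append[symmetric] append_take_drop_id by (rule refl)
    moreover have "set (take d \<pi>) \<inter> Z = {}"
      unfolding Zd[symmetric] by (rule set_take_disj_set_drop_if_distinct[OF dist order_refl])
    ultimately have Wd: "set (take d \<pi>) = W" unfolding W_def by blast
    have "take d \<pi> = sorted_list_of_set W" "drop d \<pi> = sorted_list_of_set Z"
      using Zd Wd fin sorted_between_descents(1,2)[OF dist d(1)]
      by (intro strict_sorted_equal[OF strict_sorted_list_of_set]; simp)+
    then show ?thesis unfolding \<pi>0_def using append_take_drop_id[of d \<pi>] by simp
  qed
  have "G w = (THE \<pi>. ?P \<pi>)" using assms unfolding G_def by (simp add: Let_def)
  also have "\<dots> = \<pi>0" by (rule the_equality[where P = ?P, OF ex]) (rule uniq)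
  finally have Gw: "G w = \<pi>0" .
  show ?thesis unfolding Gw by (intro exI[of _ "card W"] conjI perm0 desc0 tail0)
qed

text \<open>The word is reversed because \<open>G\<close> attaches the letter with index
  \<open>i\<close> to the value \<open>n - i + 1\<close>. With fewer than three runs,
  \<open>IG w\<close> is the identity, and \<open>rev w\<close> has no 0 before a 1, so coherence
  just means increasing. By \<open>coherent_order_isomorphic\<close> and
  \<open>order_isomorphic_perm_eq\<close> these two properties determine
  \<open>IG w\<close>.\<close>

lemma IG_coherent_perm:
  assumes "w = [] \<or> hd w = 0"
  shows "coherent (rev w) (IG w) \<and> IG w \<in> permutations_of_set {1..length w}"
proof (cases "card (runs w) \<ge> 3")
  case True
  then have "w \<noteq> []" by (auto simp: runs_def)
  then obtain d where d: "G w \<in> permutations_of_set {1..length w}" "descents (G w) = {d}"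
    "\<forall>i\<in>{1..length w}. w ! (i - 1) = 0 \<longleftrightarrow> length w - i + 1 \<in> set (drop d (G w))"
    using G_three_runs[OF _ _ True refl] assms by blast
  then have dist: "distinct (G w)" by (simp add: permutations_of_set_def)
  have "rev w ! i = 0 \<longleftrightarrow> Suc i \<in> set (drop d (G w))" if "i < length w" for i
    using d(3)[rule_format, of "length w - i"] that by (auto simp: rev_nth)
  then show ?thesis unfolding IG_def
    using coherent_inverse_perm[OF d(1)] sorted_between_descents[OF dist d(2)] inverse_perm_perm[OF d(1)]
    by simp
next
  case False
  let ?I = "[1..<Suc (length w)]"
  have I: "?I \<in> permutations_of_set {1..length w}" by (auto simp: permutations_of_set_def)
  have G: "G w = ?I" using False unfolding G_def by (simp add: Let_def)
  have nth: "inverse_perm ?I ! i = Suc i" if "i < length w" for i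
    using inverse_perm_nth[OF I that] that by (simp del: upt_Suc)
  have "coherent (rev w) (inverse_perm ?I)" unfolding coherent_nth
  proof (intro conjI allI impI)
    show len: "length (rev w) = length (inverse_perm ?I)" by (simp add: inverse_perm_def del: upt_Suc)
    fix i j assume ij: "i < j" "j < length (inverse_perm ?I)"
    then have j: "j < length w" using len by simp
    then have "w \<noteq> []" by auto
    then have "\<not> (rev w ! i = 0 \<and> rev w ! j = 1)"
    proof (intro notI)
      assume "rev w ! i = 0 \<and> rev w ! j = 1"
      then have "w ! (length w - Suc j) = 1" "w ! (length w - Suc i) = 0"
        using ij j by (auto simp: rev_nth)
      moreover have "length w - Suc j < length w - Suc i" "length w - Suc i < length w"
        using ij j by auto
      ultimately show False using three_runs_iff[OF \<open>w \<noteq> []\<close>] \<open>\<not> card (runs w) \<ge> 3\<close> assms \<open>w \<noteq> []\<close>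
        by metis
    qed
    then show "if rev w ! i = 0 \<and> rev w ! j = 1 then inverse_perm ?I ! j < inverse_perm ?I ! i
        else inverse_perm ?I ! i < inverse_perm ?I ! j"
      using nth ij j by (simp del: upt_Suc)
  qed
  then show ?thesis unfolding IG_def G using inverse_perm_perm[OF I] by blast
qed

section \<open>Block form of binary words\<close>

lemma alt_word_Nil: "alt_word [] = []"
  by (simp add: alt_word_def)

text \<open>Blocks are split off in pairs, since a shift of the index by two preserves the parity
  that selects the letter.\<close>

lemma alt_word_Cons2: "alt_word (a # b # ns) = replicate a 0 @ replicate b 1 @ alt_word ns"
proof -
  have "[0..<length (a # b # ns)] = 0 # 1 # map (\<lambda>j. Suc (Suc j)) [0..<length ns]"
    by (simp add: upt_conv_Cons map_Suc_upt[symmetric] del: upt_Suc)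
  then show ?thesis unfolding alt_word_def by (simp add: comp_def del: upt_Suc)
qed

text \<open>Induction on the word, adding a letter in front. A 1 lengthens the initial 1s. A 0
  before initial 1s turns them into the second block of a new pair; otherwise it lengthens the first
  block or, if there are no blocks, the final 0s.\<close>

lemma word_decomposition:
  "\<exists>i ns j. even (length ns) \<and> (\<forall>x\<in>set ns. x \<ge> 1) \<and>
     u = replicate i 1 @ alt_word ns @ replicate j (0 :: bit)"
proof (induction u)
  case Nil
  show ?case by (rule exI[of _ 0], rule exI[of _ "[]"], rule exI[of _ 0]) (simp add: alt_word_Nil)
next
  case (Cons c u)
  then obtain i ns j where IH: "even (length ns)" "\<forall>x\<in>set ns. x \<ge> 1"
    "u = replicate i 1 @ alt_word ns @ replicate j 0" by blast
  consider "c = 1" | "c = 0" "i > 0" | "c = 0" "i = 0" "ns = []"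
    | a b ns' where "c = 0" "i = 0" "ns = a # b # ns'"
    using IH(1) by (cases c; cases ns; cases "tl ns"; auto)
  then show ?case
  proof cases
    case 1
    then show ?thesis using IH
      by (intro exI[of _ "Suc i"] exI[of _ ns] exI[of _ j]) auto
  next
    case 2
    then show ?thesis using IH
      by (intro exI[of _ 0] exI[of _ "1 # i # ns"] exI[of _ j]) (auto simp: alt_word_Cons2)
  next
    case 3
    then show ?thesis using IH
      by (intro exI[of _ 0] exI[of _ "[]"] exI[of _ "Suc j"]) (auto simp: alt_word_Nil)
  next
    case 4
    then show ?thesis using IH
      by (intro exI[of _ 0] exI[of _ "Suc a # b # ns'"] exI[of _ j]) (auto simp: alt_word_Cons2)
  qed
qed

text \<open>Supplies the hypothesis of \<open>IG_coherent_perm\<close> for the words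
  \<open>w2\<close> of the theorem.\<close>

lemma alt_word_starts_with_0:
  assumes "even (length ns)" "\<forall>x\<in>set ns. x \<ge> 1" "w = alt_word ns @ replicate m 0"
  shows "w = [] \<or> hd w = 0"
proof (cases ns)
  case Nil
  then show ?thesis using assms by (cases m) (auto simp: alt_word_Nil)
next
  case (Cons a ns')
  then obtain b ns'' where "ns = a # b # ns''" using assms(1) by (cases ns') auto
  then show ?thesis using assms by (cases a) (auto simp: alt_word_Cons2)
qed

section \<open>Rotations and circular containment\<close>

lemma circ_append: "circ (xs @ ys) = circ (ys @ xs)"
proof -
  have "circ (b @ a) \<subseteq> circ (a @ b)" for a b :: "'a list"
    unfolding circ_def
    by (auto, metis rotate_append rotate_rotate)
  then show ?thesis by blast
qed

lemma circ_split:
  assumes "\<rho> \<in> circ \<sigma>"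
  obtains xs ys where "\<sigma> = xs @ ys" "\<rho> = ys @ xs"
proof -
  obtain k where "\<rho> = drop (k mod length \<sigma>) \<sigma> @ take (k mod length \<sigma>) \<sigma>"
    using assms unfolding circ_def rotate_drop_take by blast
  then show thesis using that[of "take (k mod length \<sigma>) \<sigma>" "drop (k mod length \<sigma>) \<sigma>"] by simp
qed

lemma append_in_circ: "ys @ xs \<in> circ (xs @ ys)"
  unfolding circ_def using rotate_append[of xs ys] by (auto intro: sym)

lemma subseq_rev: "subseq xs ys \<Longrightarrow> subseq (rev xs) (rev ys)"
  by (induction rule: list_emb.induct) (auto intro: list_emb_append_mono subseq_rev_drop_many)

lemma order_isomorphic_rotate:
  assumes "order_isomorphic s t"
  shows "order_isomorphic (rotate k s) (rotate k t)"
proof -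
  have "(k + i) mod length s < length s" if "i < length s" for i
    using that by (intro mod_less_divisor) auto
  then show ?thesis using assms by (simp add: order_isomorphic_def nth_rotate)
qed

text \<open>Rotating the pattern replaces rotating \<open>\<sigma>\<close>: an occurrence
  \<open>s1 @ s2\<close> in a rotation \<open>ys @ xs\<close> becomes an occurrence
  \<open>s2 @ s1\<close> in \<open>xs @ ys\<close>. The letters of \<open>u\<close> at the same
  positions form the subword \<open>v\<close>.\<close>

lemma circ_contains_iff_coherent:
  assumes "coherent u \<sigma>"
  shows "circ_contains \<sigma> \<tau> \<longleftrightarrow> (\<exists>v \<tau>'. subseq v u \<and> \<tau>' \<in> circ \<tau> \<and> coherent v \<tau>')"
proof
  assume "circ_contains \<sigma> \<tau>"
  then obtain \<rho> s where s: "\<rho> \<in> circ \<sigma>" "subseq s \<rho>" "order_isomorphic s \<tau>"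
    unfolding circ_contains_def by blast
  obtain xs ys where xy: "\<sigma> = xs @ ys" "\<rho> = ys @ xs" using circ_split s(1) by blast
  obtain s1 s2 where s12: "s = s1 @ s2" "subseq s1 ys" "subseq s2 xs"
    using s(2) xy by (metis subseq_appendE)
  then have "subseq (s2 @ s1) \<sigma>" unfolding xy by (simp add: list_emb_append_mono)
  then obtain v where v: "subseq v u" "coherent v (s2 @ s1)" using coherent_nths[OF assms] by (metis subseq_conv_nths)
  have "coherent v (rotate (length s1) \<tau>)"
    using order_isomorphic_coherent[OF order_isomorphic_rotate[OF s(3), of "length s1"]] v(2)
    unfolding s12(1) rotate_append by simp
  then show "\<exists>v \<tau>'. subseq v u \<and> \<tau>' \<in> circ \<tau> \<and> coherent v \<tau>'"
    using v(1) unfolding circ_def by blast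
next
  assume "\<exists>v \<tau>'. subseq v u \<and> \<tau>' \<in> circ \<tau> \<and> coherent v \<tau>'"
  then obtain v \<tau>' where v: "subseq v u" "\<tau>' \<in> circ \<tau>" "coherent v \<tau>'" by blast
  obtain s where s: "subseq s \<sigma>" "coherent v s" using coherent_nths[OF assms] v(1) by (metis subseq_conv_nths)
  have iso: "order_isomorphic s \<tau>'" using coherent_order_isomorphic s v by blast
  obtain xs ys where "\<tau> = xs @ ys" "\<tau>' = ys @ xs" using circ_split v(2) by blast
  then have \<tau>: "\<tau> = rotate (length ys) \<tau>'" by (simp add: rotate_append)
  \<comment> \<open>These are the pieces exchanged by the rotation that takes \<open>\<tau>'\<close>
    back to \<open>\<tau>\<close>; cutting \<open>\<sigma>\<close> between their embeddings gives
    the required rotation of \<open>\<sigma>\<close>.\<close>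
  let ?s1 = "take (length ys mod length s) s" and ?s2 = "drop (length ys mod length s) s"
  obtain \<sigma>1 \<sigma>2 where \<sigma>: "\<sigma> = \<sigma>1 @ \<sigma>2" "subseq ?s1 \<sigma>1" "subseq ?s2 \<sigma>2"
    using s(1) list_emb_appendD[of "(=)" ?s1 ?s2 \<sigma>] by auto
  then have "subseq (rotate (length ys) s) (\<sigma>2 @ \<sigma>1)"
    unfolding rotate_drop_take by (simp add: list_emb_append_mono)
  moreover have "order_isomorphic (rotate (length ys) s) \<tau>"
    using order_isomorphic_rotate[OF iso, of "length ys"] \<tau> by simp
  moreover have "\<sigma>2 @ \<sigma>1 \<in> circ \<sigma>" unfolding \<sigma>(1) by (rule append_in_circ)
  ultimately show "circ_contains \<sigma> \<tau>" unfolding circ_contains_def by blast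
qed

section \<open>Circular patterns of \<open>IG w1\<close> and subwords of \<open>w1\<close>\<close>

theorem theorem5p12:
  fixes w1 :: "bit list" and \<tau> :: "nat list" and n :: nat
  assumes "w1 \<noteq> []" and "hd w1 = 0" and "card (runs w1) \<ge> 3"
    and "\<tau> \<in> permutations_of_set {1..n}"
  shows "circ_contains (IG w1) \<tau> \<longleftrightarrow>
    (\<exists>w2 ns m. even (length ns) \<and> (\<forall>x\<in>set ns. x \<ge> 1) \<and>
       w2 = alt_word ns @ replicate m 0 \<and>
       circ \<tau> = circ (IG w2) \<and>
       (\<exists>i\<in>{0..m}. subseq (replicate i 1 @ alt_word ns @ replicate (m - i) 0) w1))"
proof -
  have iff: "circ_contains (IG w1) \<tau> \<longleftrightarrow>
      (\<exists>v \<tau>'. subseq v (rev w1) \<and> \<tau>' \<in> circ \<tau> \<and> coherent v \<tau>')"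
    using IG_coherent_perm[of w1] assms(2) by (intro circ_contains_iff_coherent) auto
  show ?thesis
  proof
    assume "circ_contains (IG w1) \<tau>"
    then obtain v \<tau>' where v: "subseq v (rev w1)" "\<tau>' \<in> circ \<tau>" "coherent v \<tau>'"
      unfolding iff by blast
    obtain i ns j where dec: "even (length ns)" "\<forall>x\<in>set ns. x \<ge> 1"
      "rev v = replicate i 1 @ alt_word ns @ replicate j 0" using word_decomposition by blast
    \<comment> \<open>Reversal puts the initial \<open>i\<close> 1s of \<open>rev v\<close> at the
      end of \<open>v\<close>, so the last \<open>i\<close> entries of \<open>\<tau>'\<close> are
      the block to be moved. As 0s they join the other \<open>j\<close> zeros, whence
      \<open>m = i + j\<close> in \<open>w2\<close>.\<close>
    define X where "X = take (length \<tau>' - i) \<tau>'"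
    define Y where "Y = drop (length \<tau>' - i) \<tau>'"
    define w2 where "w2 = alt_word ns @ replicate (i + j) 0"
    have veq: "v = (replicate j 0 @ rev (alt_word ns)) @ replicate i 1"
      using arg_cong[OF dec(3), of rev] by simp
    have "length \<tau>' = length v" using v(3) by (simp add: coherent_def)
    then have Y: "length Y = i" unfolding Y_def veq by simp
    have XY: "\<tau>' = X @ Y" unfolding X_def Y_def by simp
    have "coherent (replicate i 0 @ (replicate j 0 @ rev (alt_word ns))) (Y @ X)"
      using v(3) coherent_rotate[OF Y] unfolding veq XY by blast
    moreover have "rev w2 = replicate (i + j) 0 @ rev (alt_word ns)" unfolding w2_def by simp
    ultimately have coh: "coherent (rev w2) (Y @ X)" by (simp only: replicate_add append_assoc)
    obtain xs ys where xy: "\<tau> = xs @ ys" "\<tau>' = ys @ xs" by (rule circ_split[OF v(2)])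
    have circ: "circ \<tau> = circ (Y @ X)"
      using circ_append[of xs ys] circ_append[of X Y] xy XY by simp
    have IG: "coherent (rev w2) (IG w2)" "IG w2 \<in> permutations_of_set {1..length w2}"
      using IG_coherent_perm[OF alt_word_starts_with_0[OF dec(1,2) w2_def]] by simp_all
    have len: "length (Y @ X) = length w2" using coh by (simp add: coherent_def)
    \<comment> \<open>As a rearrangement of \<open>\<tau>\<close>, the list \<open>Y @ X\<close> is
      a permutation of [n]. Being coherent with \<open>rev w2\<close>, it must equal
      \<open>IG w2\<close>.\<close>
    have "mset (Y @ X) = mset (X @ Y)" by simp
    also have "\<dots> = mset \<tau>" unfolding XY[symmetric] xy by simp
    finally have eq: "mset (Y @ X) = mset \<tau>" .
    have d: "distinct (Y @ X)" and set: "set (Y @ X) = {1..n}"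
      using mset_eq_imp_distinct_iff[OF eq] mset_eq_setD[OF eq] assms(4)
      by (simp_all only: permutations_of_set_def mem_Collect_eq)
    have "n = length w2" using distinct_card[OF d] set len by simp
    then have "Y @ X \<in> permutations_of_set {1..length w2}"
      using d set by (simp only: permutations_of_set_def mem_Collect_eq)
    then have "Y @ X = IG w2"
      by (rule order_isomorphic_perm_eq[OF _ IG(2) coherent_order_isomorphic[OF coh IG(1)]])
    moreover have "subseq (replicate i 1 @ alt_word ns @ replicate (i + j - i) 0) w1"
      using v(1) dec(3) subseq_rev[of v "rev w1"] by simp
    ultimately show "\<exists>w2 ns m. even (length ns) \<and> (\<forall>x\<in>set ns. x \<ge> 1) \<and>
       w2 = alt_word ns @ replicate m 0 \<and>
       circ \<tau> = circ (IG w2) \<and>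
       (\<exists>i\<in>{0..m}. subseq (replicate i 1 @ alt_word ns @ replicate (m - i) 0) w1)"
      using dec(1,2) circ w2_def
      by (intro exI[of _ w2] exI[of _ ns] exI[of _ "i + j"] conjI bexI[of _ i]) auto
  next
    assume "\<exists>w2 ns m. even (length ns) \<and> (\<forall>x\<in>set ns. x \<ge> 1) \<and>
       w2 = alt_word ns @ replicate m 0 \<and>
       circ \<tau> = circ (IG w2) \<and>
       (\<exists>i\<in>{0..m}. subseq (replicate i 1 @ alt_word ns @ replicate (m - i) 0) w1)"
    then obtain w2 ns m i where w2: "even (length ns)" "\<forall>x\<in>set ns. x \<ge> 1"
      "w2 = alt_word ns @ replicate m 0" "circ \<tau> = circ (IG w2)" "i \<le> m"
      "subseq (replicate i 1 @ alt_word ns @ replicate (m - i) 0) w1" by auto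
    \<comment> \<open>The move is now undone: \<open>rev w2\<close> begins with
      \<open>m \<ge> i\<close> zeros, and the entries \<open>Y\<close> at the first \<open>i\<close>
      of them go to the end, relabelled 1.\<close>
    define u where "u = replicate (m - i) 0 @ rev (alt_word ns)"
    define Y where "Y = take i (IG w2)"
    define X where "X = drop i (IG w2)"
    have coh: "coherent (rev w2) (IG w2)"
      using IG_coherent_perm[OF alt_word_starts_with_0[OF w2(1-3)]] by simp
    then have "length (IG w2) = length w2" by (simp add: coherent_def)
    then have Y: "length Y = i" using w2(3,5) unfolding Y_def by simp
    have "rev w2 = replicate i 0 @ u"
      using w2(3,5) unfolding u_def by (simp add: replicate_add[symmetric])
    then have "coherent (u @ replicate i 1) (X @ Y)"
      using coh coherent_rotate[OF Y] unfolding X_def Y_def by simp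
    moreover have "X @ Y \<in> circ \<tau>"
      unfolding w2(4) using append_in_circ[of X Y] unfolding X_def Y_def by simp
    moreover have "subseq (u @ replicate i 1) (rev w1)"
      using subseq_rev[OF w2(6)] unfolding u_def by simp
    ultimately show "circ_contains (IG w1) \<tau>" unfolding iff by blast
  qed
qed

end
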